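(* Let $(S,\mathcal{A},\mu)$ be a complete, finite measure space, $1\leq p<\infty$ and $X$ a Banach space with the uniform Opial property. Let $p<r\leq\infty$ and $\varepsilon,M,R,K>0$. Then there exists $\eta>0$ such that the following holds: whenever $(f_n)_{n\in\mathbb{N}}$ is a sequence in $L^p(\mu,X)$ with $\sup_{n\in\mathbb{N}}\|f_n\|_p\leq R$ such that, for almost every $t\in S$, $(f_n(t))_{n\in\mathbb{N}}$ converges weakly to zero and $\lim_{n\to\infty}\|f_n(t)\|$ exists and is at most $M$, and whenever $f\in L^r(\mu,X)\subseteq L^p(\mu,X)$ is such that $\|f\|_r\leq K$ and $\|f\|_p\geq\varepsilon$, then $$\limsup_{n\to\infty}\|f_n\|_p+\eta\leq\limsup_{n\to\infty}\|f_n-f\|_p.$$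
   Context: All Banach spaces are real. For $1\leq q\leq\infty$ the Lebesgue-Bochner space $L^q(\mu,X)$ is the space of all Bochner-measurable functions $f:S\to X$ (modulo equality $\mu$-almost everywhere) with $\|f(\cdot)\|\in L^q(\mu)$, normed by $\|f\|_q:=\|\,\|f(\cdot)\|\,\|_q$. A Banach space $X$ has the uniform Opial property if for every $c>0$ there is some $\rho>0$ such that $1+\rho\leq\liminf_{n\to\infty}\|x_n-x\|$ for every $x\in X$ with $\|x\|\geq c$ and every weakly null sequence $(x_n)_{n\in\mathbb{N}}$ in $X$ with $\liminf_{n\to\infty}\|x_n\|\geq 1$. Equivalently: for every $\varepsilon>0$ and $R>0$ there is some $\eta>0$ such that $\eta+\liminf_{n\to\infty}\|x_n\|\leq\liminf_{n\to\infty}\|x_n-x\|$ for all $x\in X$ with $\|x\|\geq\varepsilon$ and every weakly null sequence $(x_n)_{n\in\mathbb{N}}$ in $X$ with $\limsup_{n\to\infty}\|x_n\|\leq R$. *)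

theory Defs
  imports "HOL-Analysis.Analysis" "HOL-Probability.Essential_Supremum"
begin

definition weakly_converges :: "(nat \<Rightarrow> 'x::real_normed_vector) \<Rightarrow> 'x \<Rightarrow> bool" where
  "weakly_converges xs x \<longleftrightarrow>
    (\<forall>\<phi>::'x \<Rightarrow> real. bounded_linear \<phi> \<longrightarrow> (\<lambda>n. \<phi> (xs n)) \<longlonglongrightarrow> \<phi> x)"

text \<open>The lower limits are taken in the extended reals, where they always exist.\<close>

definition uniform_opial :: "'x::real_normed_vector itself \<Rightarrow> bool" where
  "uniform_opial _ \<longleftrightarrow>
    (\<forall>c::real. c > 0 \<longrightarrow> (\<exists>\<rho>::real. \<rho> > 0 \<and>
      (\<forall>(x::'x) (xs::nat \<Rightarrow> 'x).
        norm x \<ge> c \<longrightarrow> weakly_converges xs 0 \<longrightarrow> liminf (\<lambda>n. ereal (norm (xs n))) \<ge> 1 \<longrightarrow>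
        1 + ereal \<rho> \<le> liminf (\<lambda>n. ereal (norm (xs n - x))))))"

text \<open>
  Bochner measurability is strong measurability: being an almost everywhere limit of simple
  functions. The space \<open>'x\<close> need not be separable, so Borel measurability would be too weak.
\<close>

definition bochner_measurable :: "'s measure \<Rightarrow> ('s \<Rightarrow> 'x::real_normed_vector) \<Rightarrow> bool" where
  "bochner_measurable \<mu> f \<longleftrightarrow>
    (\<exists>s::nat \<Rightarrow> 's \<Rightarrow> 'x. (\<forall>i. simple_function \<mu> (s i)) \<and>
      (AE t in \<mu>. (\<lambda>i. s i t) \<longlonglongrightarrow> f t))"

text \<open>
  Elements of the Lebesgue-Bochner space \<open>L\<^sup>q(\<mu>, X)\<close> are given by
  representatives, without passing to the quotient by
  almost everywhere equality. The exponent \<open>q\<close> is meant to satisfy \<open>1 \<le> q \<le> \<infinity>\<close>. The essential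
  supremum is taken in the nonnegative extended reals, so that it is 0 (not \<open>-\<infinity>\<close>) for the
  zero measure; it is \<open>top\<close> for a non-measurable function.
\<close>

definition bochner_Lq :: "'s measure \<Rightarrow> ereal \<Rightarrow> ('s \<Rightarrow> 'x::real_normed_vector) set" where
  "bochner_Lq \<mu> q = {f. bochner_measurable \<mu> f \<and>
    (if q = \<infinity> then esssup \<mu> (\<lambda>t. ennreal (norm (f t))) < top
     else integrable \<mu> (\<lambda>t. norm (f t) powr real_of_ereal q))}"

definition Lq_norm :: "'s measure \<Rightarrow> ereal \<Rightarrow> ('s \<Rightarrow> 'x::real_normed_vector) \<Rightarrow> real" where
  "Lq_norm \<mu> q f =
    (if q = \<infinity> then enn2real (esssup \<mu> (\<lambda>t. ennreal (norm (f t))))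
     else (\<integral>t. norm (f t) powr real_of_ereal q \<partial>\<mu>) powr (1 / real_of_ereal q))"

end

theory Submission
  imports Defs
begin

text \<open>
  At a point \<open>t\<close> where \<open>norm (f t) \<ge> \<delta>\<close>, the uniform Opial property yields a gap \<open>\<eta>0 > 0\<close> that
  depends on \<open>\<delta>\<close> and \<open>M\<close> only: \<open>liminf norm (F n t - f t) \<ge> lim norm (F n t) + \<eta>0\<close>
  (\<open>uniform_opial_gap\<close>). At every other point the same holds with gap 0. Since \<open>1 \<le> p\<close>, powers are
  superadditive on the nonnegative reals, so the gap survives taking \<open>p\<close>-th powers and becomes
  \<open>\<eta>0 powr p\<close>.

  This gap is integrated with Fatou's lemma. The difference
  \<open>norm (F n t - f t) powr p - norm (F n t) powr p\<close> has in general no integrable lower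
  bound common to all \<open>n\<close>, because the powers \<open>norm (F n t) powr p\<close> are bounded in mean but may
  concentrate. As in the Brezis-Lieb lemma, it becomes nonnegative after adding
  \<open>e * norm (F n t) powr p + C * norm (f t) powr p\<close>,
  with \<open>e\<close> as small as desired; the second term is the same for all \<open>n\<close>, and the first costs at most
  \<open>e * R powr p\<close> in the integrals. Hence the integrals of the \<open>p\<close>-th powers eventually differ by
  almost \<open>\<eta>0 powr p\<close> times the measure of \<open>{t. \<delta> \<le> norm (f t)}\<close> (\<open>Fatou_powr_diff\<close>).

  A lower bound for that measure, uniform in \<open>f\<close>, is where \<open>p < r\<close> enters: the functions
  \<open>norm (f t) powr p\<close> with \<open>Lq_norm \<mu> r f \<le> K\<close> are uniformly integrable, so a norm
  \<open>Lq_norm \<mu> p f \<ge> \<epsilon>\<close> can come neither from very small values of \<open>f\<close> nor from a set of very small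
  measure (\<open>level_set_measure_ge\<close>). Finally, a gap between \<open>p\<close>-th powers of norms is a gap between the
  norms, uniformly as long as the smaller one stays below \<open>R\<close> (\<open>powr_gap_root\<close>).
\<close>

section \<open>Inequalities for real powers\<close>

lemma powr_superadd:
  fixes x y p :: real
  assumes "1 \<le> p" "0 \<le> x" "0 \<le> y"
  shows "x powr p + y powr p \<le> (x + y) powr p"
proof -
  have split: "z powr p = z * z powr (p - 1)" if "0 \<le> z" for z :: real
    using that by (cases "z = 0") (auto simp: powr_mult_base)
  have "x * x powr (p - 1) + y * y powr (p - 1) \<le> x * (x + y) powr (p - 1) + y * (x + y) powr (p - 1)"
    using assms by (intro add_mono mult_left_mono powr_mono2) auto
  also have "\<dots> = (x + y) powr p"
    using assms by (subst split[of "x + y"]) (auto simp: algebra_simps)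
  finally show ?thesis
    using assms split[of x] split[of y] by simp
qed

lemma powr_add_le:
  fixes x y p :: real
  assumes "0 \<le> p" "0 \<le> x" "0 \<le> y"
  shows "(x + y) powr p \<le> 2 powr p * (x powr p + y powr p)"
proof -
  have "(x + y) powr p \<le> (2 * max x y) powr p"
    using assms by (intro powr_mono2) auto
  also have "\<dots> = 2 powr p * max x y powr p"
    using assms by (simp add: powr_mult)
  also have "\<dots> \<le> 2 powr p * (x powr p + y powr p)"
    by (intro mult_left_mono) (auto simp: max_def)
  finally show ?thesis .
qed

text \<open>
  The inequality behind the Brezis-Lieb lemma. If \<open>g\<close> is a small fraction of \<open>a\<close>, then \<open>b\<close> is
  nearly as large as \<open>a\<close>, and the loss is a small multiple of \<open>a powr p\<close>; otherwise \<open>a\<close> is at most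
  a fixed multiple of \<open>g\<close>.
\<close>

lemma powr_perturbation:
  fixes p \<epsilon> :: real
  assumes "0 \<le> p" "0 < \<epsilon>"
  obtains C where "0 \<le> C"
    "\<And>a b g :: real. \<lbrakk>0 \<le> a; 0 \<le> b; 0 \<le> g; a - g \<le> b\<rbrakk> \<Longrightarrow> a powr p \<le> b powr p + \<epsilon> * a powr p + C * g powr p"
proof -
  have "((\<lambda>k::real. (1 - k) powr p) \<longlongrightarrow> (1 - 0) powr p) (at_right 0)"
    by (intro tendsto_intros) auto
  then have "\<forall>\<^sub>F k in at_right 0. 1 - \<epsilon> < (1 - k::real) powr p"
    by (rule order_tendstoD) (use assms in auto)
  moreover have "\<forall>\<^sub>F k in at_right (0::real). k < 1"
    by (rule eventually_at_right_real[THEN eventually_mono, of 0 1]) auto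
  moreover have "\<forall>\<^sub>F k in at_right (0::real). 0 < k"
    by (simp add: eventually_at_right_less)
  ultimately have "\<forall>\<^sub>F k in at_right (0::real). 0 < k \<and> k < 1 \<and> 1 - \<epsilon> < (1 - k) powr p"
    by eventually_elim auto
  then obtain k :: real where k: "0 < k" "k < 1" "1 - \<epsilon> < (1 - k) powr p"
    using eventually_happens'[OF trivial_limit_at_right_real] by blast
  show thesis
  proof (rule that[of "(1 / k) powr p"])
    fix a b g :: real assume ab: "0 \<le> a" "0 \<le> b" "0 \<le> g" "a - g \<le> b"
    show "a powr p \<le> b powr p + \<epsilon> * a powr p + (1 / k) powr p * g powr p"
    proof (cases "g \<le> k * a")
      case True
      have "(1 - \<epsilon>) * a powr p \<le> (1 - k) powr p * a powr p"
        using k by (intro mult_right_mono) auto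
      also have "\<dots> = ((1 - k) * a) powr p"
        using k ab by (simp add: powr_mult)
      also have "\<dots> \<le> b powr p"
        using ab k True assms by (intro powr_mono2 mult_nonneg_nonneg) (auto simp: algebra_simps)
      finally have "(1 - \<epsilon>) * a powr p \<le> b powr p" .
      moreover have "0 \<le> (1 / k) powr p * g powr p"
        by simp
      ultimately show ?thesis
        unfolding left_diff_distrib mult_1 by linarith
    next
      case False
      then have "a powr p \<le> (1 / k * g) powr p"
        using ab k assms by (intro powr_mono2) (auto simp: field_simps)
      also have "\<dots> = (1 / k) powr p * g powr p"
        using ab k by (subst powr_mult) auto
      finally show ?thesis
        using assms by (smt (verit) mult_nonneg_nonneg powr_ge_zero)
    qed
  qed auto
qed

text \<open>
  Returns from \<open>p\<close>-th powers to norms. The bound \<open>R\<close> on \<open>a\<close> gives one \<open>\<eta>\<close> for all \<open>a\<close>, by uniform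
  continuity of the power on a compact interval.
\<close>

lemma powr_gap_root:
  fixes p R \<gamma> :: real
  assumes "0 < p" "0 < \<gamma>"
  obtains \<eta> where "0 < \<eta>"
    "\<And>a b. \<lbrakk>0 \<le> a; a \<le> R; 0 \<le> b; a powr p + \<gamma> \<le> b powr p\<rbrakk> \<Longrightarrow> a + \<eta> \<le> b"
proof -
  have "continuous_on {0..R+1} (\<lambda>x. x powr p)"
    using assms by (intro continuous_on_powr' continuous_intros) auto
  then have "uniformly_continuous_on {0..R+1} (\<lambda>x. x powr p)"
    by (rule compact_uniformly_continuous) simp
  then obtain d where d: "d > 0"
    "\<And>x y. \<lbrakk>x \<in> {0..R+1}; y \<in> {0..R+1}; dist y x < d\<rbrakk> \<Longrightarrow> dist (y powr p) (x powr p) < \<gamma>"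
    using assms(2) unfolding uniformly_continuous_on_def by metis
  \<comment> \<open>The cap 1 keeps \<open>a + \<eta>\<close> inside the interval \<open>{0..R+1}\<close>.\<close>
  show thesis
  proof (rule that[of "min 1 (d / 2)"])
    fix a b assume ab: "0 \<le> a" "a \<le> R" "0 \<le> b" "a powr p + \<gamma> \<le> b powr p"
    show "a + min 1 (d / 2) \<le> b"
    proof (rule ccontr)
      let ?c = "a + min 1 (d / 2)"
      assume "\<not> ?c \<le> b"
      then have "b powr p \<le> ?c powr p"
        using ab assms by (intro powr_mono2) auto
      moreover have "dist (?c powr p) (a powr p) < \<gamma>"
        using ab d(1) by (intro d(2)) (auto simp: dist_real_def)
      ultimately show False
        using ab by (simp add: dist_real_def)
    qed
  qed (use d in auto)
qed

section \<open>The pointwise gap\<close>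

text \<open>
  The defining inequality speaks of sequences with lower limit of norms at least 1, so \<open>xs\<close> is divided
  by the limit \<open>l\<close> of its norms. The constant it then gives depends on \<open>norm x / l \<ge> \<delta> / M\<close> only, but
  scaling back multiplies the gap by \<open>l\<close>. When \<open>l\<close> is small compared with \<open>\<delta>\<close> the triangle inequality
  gives a gap directly.
\<close>

lemma uniform_opial_gap:
  assumes opial: "uniform_opial TYPE('x::real_normed_vector)" and "0 < \<delta>" "0 < M"
  obtains \<eta> where "0 < \<eta>"
    "\<And>(x::'x) xs l. \<lbrakk>\<delta> \<le> norm x; weakly_converges xs 0; (\<lambda>n. norm (xs n)) \<longlonglongrightarrow> l; l \<le> M\<rbrakk>
      \<Longrightarrow> ereal (l + \<eta>) \<le> liminf (\<lambda>n. ereal (norm (xs n - x)))"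
proof -
  have "0 < \<delta> / M"
    using assms by simp
  then obtain \<rho> where \<rho>: "\<rho> > 0"
    "\<And>(x::'x) xs. \<lbrakk>\<delta> / M \<le> norm x; weakly_converges xs 0; 1 \<le> liminf (\<lambda>n. ereal (norm (xs n)))\<rbrakk>
      \<Longrightarrow> 1 + ereal \<rho> \<le> liminf (\<lambda>n. ereal (norm (xs n - x)))"
    using opial unfolding uniform_opial_def by metis
  show thesis
  proof (rule that[of "min (\<delta> / 2) (\<rho> * (\<delta> / 4))"])
    show "0 < min (\<delta> / 2) (\<rho> * (\<delta> / 4))"
      using assms \<rho> by simp
  next
    fix x :: 'x and xs :: "nat \<Rightarrow> 'x" and l :: real
    assume x: "\<delta> \<le> norm x" and w: "weakly_converges xs 0"
      and lim: "(\<lambda>n. norm (xs n)) \<longlonglongrightarrow> l" and "l \<le> M"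
    show "ereal (l + min (\<delta> / 2) (\<rho> * (\<delta> / 4))) \<le> liminf (\<lambda>n. ereal (norm (xs n - x)))"
    proof (cases "l \<le> \<delta> / 4")
      case True
      \<comment> \<open>Here \<open>norm x - l \<ge> \<delta> - \<delta> / 4 \<ge> l + \<delta> / 2\<close>.\<close>
      have "(\<lambda>n. ereal (norm x - norm (xs n))) \<longlonglongrightarrow> ereal (norm x - l)"
        by (intro tendsto_intros lim)
      then have "liminf (\<lambda>n. ereal (norm x - norm (xs n))) = ereal (norm x - l)"
        by (rule lim_imp_Liminf[OF sequentially_bot])
      moreover have "liminf (\<lambda>n. ereal (norm x - norm (xs n))) \<le> liminf (\<lambda>n. ereal (norm (xs n - x)))"
      proof (intro Liminf_mono always_eventually allI)
        fix n show "ereal (norm x - norm (xs n)) \<le> ereal (norm (xs n - x))"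
          using norm_triangle_ineq2[of x "xs n"] by (simp add: norm_minus_commute)
      qed
      moreover have "l + min (\<delta> / 2) (\<rho> * (\<delta> / 4)) \<le> norm x - l"
        using True x by auto
      ultimately show ?thesis
        by (metis ereal_less_eq(3) order_trans)
    next
      case False
      then have l: "0 < l"
        using assms by simp
      define ys where "ys n = xs n /\<^sub>R l" for n
      have "weakly_converges ys 0"
        unfolding weakly_converges_def
      proof (intro allI impI)
        fix \<phi> :: "'x \<Rightarrow> real" assume \<phi>: "bounded_linear \<phi>"
        then have "(\<lambda>n. \<phi> (xs n) / l) \<longlonglongrightarrow> \<phi> 0 / l"
          using w l unfolding weakly_converges_def by (intro tendsto_divide tendsto_const) auto
        then show "(\<lambda>n. \<phi> (ys n)) \<longlonglongrightarrow> \<phi> 0"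
          using \<phi> by (simp add: ys_def linear_simps divide_inverse_commute)
      qed
      moreover have "(\<lambda>n. inverse l * norm (xs n)) \<longlonglongrightarrow> inverse l * l"
        by (intro tendsto_intros lim)
      then have "(\<lambda>n. ereal (norm (ys n))) \<longlonglongrightarrow> ereal (inverse l * l)"
        using l by (simp add: ys_def)
      then have "liminf (\<lambda>n. ereal (norm (ys n))) = ereal (inverse l * l)"
        by (rule lim_imp_Liminf[OF sequentially_bot])
      then have "1 \<le> liminf (\<lambda>n. ereal (norm (ys n)))"
        using l by simp
      moreover have "\<delta> / M \<le> norm (x /\<^sub>R l)"
        using x l \<open>l \<le> M\<close> assms
          frac_le[of "norm x" \<delta> l M] by (simp add: divide_inverse_commute)
      ultimately have "ereal (1 + \<rho>) \<le> liminf (\<lambda>n. ereal (norm (ys n - x /\<^sub>R l)))"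
        using \<rho>(2)[of "x /\<^sub>R l" ys] by (simp add: add.commute)
      then have scaled: "\<forall>\<^sub>F n in sequentially. c < norm (ys n - x /\<^sub>R l)" if "c < 1 + \<rho>" for c
        unfolding le_Liminf_iff using that by (auto dest!: spec[where x = "ereal c"])
      have norm_scaled: "norm (xs n - x) = l * norm (ys n - x /\<^sub>R l)" for n
        using l by (simp add: ys_def scaleR_diff_right[symmetric])
      have "ereal (l * (1 + \<rho>)) \<le> liminf (\<lambda>n. ereal (norm (xs n - x)))"
        unfolding le_Liminf_iff
      proof (intro allI impI)
        fix y :: ereal assume y: "y < ereal (l * (1 + \<rho>))"
        show "\<forall>\<^sub>F n in sequentially. y < ereal (norm (xs n - x))"
        proof (cases y)
          case (real c)
          then have "c / l < 1 + \<rho>"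
            using y l by (simp add: field_simps)
          from scaled[OF this] show ?thesis
            by eventually_elim (use real l in \<open>simp add: norm_scaled field_simps\<close>)
        qed (use y in auto)
      qed
      moreover have "l + min (\<delta> / 2) (\<rho> * (\<delta> / 4)) \<le> l * (1 + \<rho>)"
      proof -
        have "\<rho> * (\<delta> / 4) \<le> \<rho> * l"
          using False \<rho> by (intro mult_left_mono) auto
        then show ?thesis
          by (simp add: algebra_simps min_le_iff_disj)
      qed
      ultimately show ?thesis
        by (meson ereal_less_eq(3) order_trans)
    qed
  qed
qed

text \<open>
  Used at the points where \<open>norm (f t)\<close> is below the threshold, so that these do not destroy the gap
  gained elsewhere. For \<open>x \<noteq> 0\<close> it follows from the previous lemma with \<open>\<delta> = norm x\<close>.
\<close>

lemma uniform_opial_liminf_ge: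
  assumes "uniform_opial TYPE('x::real_normed_vector)"
    and "weakly_converges xs (0::'x)" and lim: "(\<lambda>n. norm (xs n)) \<longlonglongrightarrow> l"
  shows "ereal l \<le> liminf (\<lambda>n. ereal (norm (xs n - x)))"
proof (cases "x = 0")
  case True
  have "(\<lambda>n. ereal (norm (xs n))) \<longlonglongrightarrow> ereal l"
    using lim by (intro tendsto_intros)
  then have "liminf (\<lambda>n. ereal (norm (xs n))) = ereal l"
    by (rule lim_imp_Liminf[OF sequentially_bot])
  then show ?thesis
    using True by simp
next
  case False
  then have "0 < norm x"
    by simp
  from uniform_opial_gap[OF assms(1) this, of "max 1 l"] obtain \<eta> where \<eta>: "0 < \<eta>"
    "\<And>(y::'x) ys k. \<lbrakk>norm x \<le> norm y; weakly_converges ys 0; (\<lambda>n. norm (ys n)) \<longlonglongrightarrow> k; k \<le> max 1 l\<rbrakk>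
      \<Longrightarrow> ereal (k + \<eta>) \<le> liminf (\<lambda>n. ereal (norm (ys n - y)))"
    by (metis less_max_iff_disj zero_less_one)
  have "ereal l \<le> ereal (l + \<eta>)"
    using \<eta>(1) by simp
  also have "\<dots> \<le> liminf (\<lambda>n. ereal (norm (xs n - x)))"
    by (rule \<eta>(2)[OF order_refl assms(2) lim]) simp
  finally show ?thesis .
qed

text \<open>
  With limits, the claim is \<open>(l + \<eta>) powr p - l powr p \<ge> \<eta> powr p\<close>, which is superadditivity; the
  difference is compared with every \<open>c\<close> below \<open>\<eta> powr p\<close> because only a lower limit of \<open>b\<close> is controlled.
\<close>

lemma eventually_powr_diff_gt:
  fixes a b :: "nat \<Rightarrow> real" and l \<eta> p c :: real
  assumes "1 \<le> p" "0 \<le> \<eta>" "\<And>n. 0 \<le> a n" "\<And>n. 0 \<le> b n"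
    and lim: "a \<longlonglongrightarrow> l" and gap: "ereal (l + \<eta>) \<le> liminf (\<lambda>n. ereal (b n))"
    and "c < \<eta> powr p"
  shows "\<forall>\<^sub>F n in sequentially. c < b n powr p - a n powr p"
proof -
  have l: "0 \<le> l"
    using lim assms(3) by (intro LIMSEQ_le_const) auto
  let ?z = "(\<eta> powr p - c) / 2"
  have "(\<lambda>n. a n powr p) \<longlonglongrightarrow> l powr p"
    using lim assms by (intro tendsto_powr' tendsto_const) auto
  then have 1: "\<forall>\<^sub>F n in sequentially. a n powr p < l powr p + ?z"
    by (rule order_tendstoD) (use assms in auto)
  \<comment> \<open>The maximum with 0 covers \<open>l + \<eta> = 0\<close>, where \<open>l + \<eta> - e\<close> leaves the domain of the power.\<close>
  have "((\<lambda>e. (max 0 (l + \<eta> - e)) powr p) \<longlongrightarrow> (max 0 (l + \<eta> - 0)) powr p) (at_right 0)"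
    using assms by (intro tendsto_powr' tendsto_intros) auto
  then have "\<forall>\<^sub>F e in at_right 0. (l + \<eta>) powr p - ?z < (max 0 (l + \<eta> - e)) powr p"
    by (rule order_tendstoD) (use assms l in auto)
  moreover have "\<forall>\<^sub>F e in at_right (0::real). 0 < e"
    by (simp add: eventually_at_right_less)
  ultimately have "\<forall>\<^sub>F e in at_right (0::real). 0 < e \<and> (l + \<eta>) powr p - ?z < (max 0 (l + \<eta> - e)) powr p"
    by eventually_elim auto
  then obtain e where e: "0 < e" "(l + \<eta>) powr p - ?z < (max 0 (l + \<eta> - e)) powr p"
    using eventually_happens'[OF trivial_limit_at_right_real] by blast
  have "ereal (l + \<eta> - e) < ereal (l + \<eta>)"
    using e by simp
  then have "\<forall>\<^sub>F n in sequentially. ereal (l + \<eta> - e) < ereal (b n)"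
    using gap unfolding le_Liminf_iff by blast
  with 1 show ?thesis
  proof eventually_elim
    case (elim n)
    have "(max 0 (l + \<eta> - e)) powr p \<le> b n powr p"
      using elim assms by (intro powr_mono2) auto
    moreover have "l powr p + \<eta> powr p \<le> (l + \<eta>) powr p"
      using assms l by (intro powr_superadd)
    ultimately show ?case
      using elim e by (simp add: field_simps)
  qed
qed

section \<open>Measurability and integrability\<close>

text \<open>
  The limit agrees almost everywhere with the measurable function \<open>lim (\<lambda>i. s i t)\<close>; in a complete
  measure space changing a measurable function on a null set keeps it measurable.
\<close>

lemma borel_measurable_AE_limit:
  fixes f :: "'s \<Rightarrow> real"
  assumes "complete_measure \<mu>" and [measurable]: "\<And>i. s i \<in> borel_measurable \<mu>"
    and "AE t in \<mu>. (\<lambda>i. s i t) \<longlonglongrightarrow> f t"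
  shows "f \<in> borel_measurable \<mu>"
proof -
  have eq: "AE t in \<mu>. f t = lim (\<lambda>i. s i t)"
    using assms(3) by eventually_elim (simp add: limI)
  show ?thesis
  proof (rule measurableI)
    fix A :: "real set" assume [measurable]: "A \<in> sets borel"
    have "AE t in \<mu>. (t \<in> (\<lambda>t. lim (\<lambda>i. s i t)) -` A \<inter> space \<mu>) = (t \<in> f -` A \<inter> space \<mu>)"
      using eq by eventually_elim simp
    then show "f -` A \<inter> space \<mu> \<in> sets \<mu>"
      by (rule complete_measure.in_sets_AE[OF assms(1)]) auto
  qed auto
qed

lemma bochner_measurable_norm:
  assumes "complete_measure \<mu>" "bochner_measurable \<mu> f"
  shows "(\<lambda>t. norm (f t)) \<in> borel_measurable \<mu>"
proof -
  obtain s where s: "\<And>i. simple_function \<mu> (s i)" "AE t in \<mu>. (\<lambda>i. s i t) \<longlonglongrightarrow> f t"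
    using assms unfolding bochner_measurable_def by auto
  show ?thesis
  proof (rule borel_measurable_AE_limit[OF assms(1)])
    show "(\<lambda>t. norm (s i t)) \<in> borel_measurable \<mu>" for i
      using s(1)[of i] by (intro borel_measurable_simple_function) (rule simple_function_compose1)
    show "AE t in \<mu>. (\<lambda>i. norm (s i t)) \<longlonglongrightarrow> norm (f t)"
      using s(2) by eventually_elim (rule tendsto_norm)
  qed
qed

lemma bochner_measurable_diff:
  assumes "bochner_measurable \<mu> f" "bochner_measurable \<mu> g"
  shows "bochner_measurable \<mu> (\<lambda>t. f t - g t)"
proof -
  obtain s where s: "\<And>i. simple_function \<mu> (s i)" "AE t in \<mu>. (\<lambda>i. s i t) \<longlonglongrightarrow> f t"
    using assms unfolding bochner_measurable_def by auto
  obtain u where u: "\<And>i. simple_function \<mu> (u i)" "AE t in \<mu>. (\<lambda>i. u i t) \<longlonglongrightarrow> g t"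
    using assms unfolding bochner_measurable_def by auto
  have "AE t in \<mu>. (\<lambda>i. s i t - u i t) \<longlonglongrightarrow> f t - g t"
    using s(2) u(2) by eventually_elim (rule tendsto_diff)
  moreover have "simple_function \<mu> (\<lambda>t. s i t - u i t)" for i
    using s(1) u(1) by (rule simple_function_compose2)
  ultimately show ?thesis
    unfolding bochner_measurable_def by (intro exI[of _ "\<lambda>i t. s i t - u i t"]) simp
qed

text \<open>
  Truncation at height \<open>T\<close>: where \<open>norm (f t) > T\<close>, one has
  \<open>norm (f t) powr p \<le> T powr (p - q) * norm (f t) powr q\<close> for \<open>q > p\<close>, and the factor
  \<open>T powr (p - q)\<close> is small for large \<open>T\<close>. This replaces an application of Hoelder's inequality on a set
  of small measure. For \<open>r = \<infinity>\<close> the function is bounded and nothing is left over.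
\<close>

lemma Lr_ball_uniformly_integrable:
  fixes \<mu> :: "'s measure" and p K \<theta> :: real and r :: ereal
  assumes "1 \<le> p" "ereal p < r" "0 < K" "0 < \<theta>"
  obtains T where "0 \<le> T"
    "\<And>f :: 's \<Rightarrow> 'x::real_normed_vector. \<lbrakk>f \<in> bochner_Lq \<mu> r; Lq_norm \<mu> r f \<le> K\<rbrakk> \<Longrightarrow>
      \<exists>w. integrable \<mu> w \<and> integral\<^sup>L \<mu> w \<le> \<theta> \<and> (\<forall>t. 0 \<le> w t) \<and>
        (AE t in \<mu>. norm (f t) powr p \<le> T + w t)"
proof (cases "r = \<infinity>")
  case True
  show thesis
  proof (rule that[of "K powr p"])
    fix f :: "'s \<Rightarrow> 'x" assume f: "f \<in> bochner_Lq \<mu> r" "Lq_norm \<mu> r f \<le> K"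
    let ?e = "esssup \<mu> (\<lambda>t. ennreal (norm (f t)))"
    have "?e < top" "enn2real ?e \<le> K"
      using f True by (auto simp: bochner_Lq_def Lq_norm_def)
    then have e: "?e \<le> ennreal K"
      by (metis ennreal_enn2real ennreal_leI)
    have "AE t in \<mu>. norm (f t) powr p \<le> K powr p"
      using esssup_AE[of "\<lambda>t. ennreal (norm (f t))" \<mu>]
    proof eventually_elim
      case (elim t)
      then have "ennreal (norm (f t)) \<le> ennreal K"
        using e by (rule order_trans)
      then show ?case
        using assms by (intro powr_mono2) auto
    qed
    then show "\<exists>w. integrable \<mu> w \<and> integral\<^sup>L \<mu> w \<le> \<theta> \<and> (\<forall>t. 0 \<le> w t) \<and>
        (AE t in \<mu>. norm (f t) powr p \<le> K powr p + w t)"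
      using assms by (intro exI[of _ "\<lambda>_. 0"]) simp
  qed simp
next
  case False
  then obtain q where r: "r = ereal q"
    using assms by (cases r) auto
  then have q: "p < q"
    using assms by simp
  \<comment> \<open>The height for which the part above it has integral at most \<open>\<theta>\<close>.\<close>
  define T where "T = (\<theta> / K powr q) powr (1 / (p - q))"
  have T: "0 < T" "T powr (p - q) = \<theta> / K powr q"
    using q assms by (auto simp: T_def powr_powr)
  show thesis
  proof (rule that[of "T powr p"])
    fix f :: "'s \<Rightarrow> 'x" assume f: "f \<in> bochner_Lq \<mu> r" "Lq_norm \<mu> r f \<le> K"
    let ?I = "\<integral>t. norm (f t) powr q \<partial>\<mu>"
    have int: "integrable \<mu> (\<lambda>t. norm (f t) powr q)" and "?I powr (1 / q) \<le> K"
      using f r by (auto simp: bochner_Lq_def Lq_norm_def)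
    then have "(?I powr (1 / q)) powr q \<le> K powr q"
      using q assms by (intro powr_mono2) auto
    then have I: "?I \<le> K powr q"
      using q assms by (simp add: powr_powr)
    have "norm (f t) powr p \<le> T powr p + T powr (p - q) * norm (f t) powr q" for t
    proof (cases "norm (f t) \<le> T")
      case True
      then have "norm (f t) powr p \<le> T powr p"
        using assms by (intro powr_mono2) auto
      then show ?thesis
        by (smt (verit) mult_nonneg_nonneg powr_ge_zero)
    next
      case False
      have "norm (f t) powr p = norm (f t) powr (p - q) * norm (f t) powr q"
        by (simp add: powr_add[symmetric])
      also have "\<dots> \<le> T powr (p - q) * norm (f t) powr q"
        using False T q by (intro mult_right_mono powr_mono2') auto
      finally show ?thesis
        by (smt (verit) powr_ge_zero)
    qed
    moreover have "T powr (p - q) * ?I \<le> T powr (p - q) * K powr q"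
      using I by (intro mult_left_mono) auto
    then have "(\<integral>t. T powr (p - q) * norm (f t) powr q \<partial>\<mu>) \<le> \<theta>"
      using T assms by simp
    ultimately show "\<exists>w. integrable \<mu> w \<and> integral\<^sup>L \<mu> w \<le> \<theta> \<and> (\<forall>t. 0 \<le> w t) \<and>
        (AE t in \<mu>. norm (f t) powr p \<le> T powr p + w t)"
      using int by (intro exI[of _ "\<lambda>t. T powr (p - q) * norm (f t) powr q"]) auto
  qed simp
qed

lemma Lr_subset_Lp:
  fixes f :: "'s \<Rightarrow> 'x::real_normed_vector"
  assumes "complete_measure \<mu>" "finite_measure \<mu>" "1 \<le> p" "ereal p < r" "f \<in> bochner_Lq \<mu> r"
  shows "f \<in> bochner_Lq \<mu> (ereal p)"
proof -
  interpret finite_measure \<mu> by fact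
  have bm: "bochner_measurable \<mu> f"
    using assms by (simp add: bochner_Lq_def)
  note [measurable] = bochner_measurable_norm[OF assms(1) bm]
  let ?K = "max 1 (Lq_norm \<mu> r f)"
  have "0 < ?K"
    by simp
  then obtain T where T: "0 \<le> T"
    "\<And>h :: 's \<Rightarrow> 'x. \<lbrakk>h \<in> bochner_Lq \<mu> r; Lq_norm \<mu> r h \<le> ?K\<rbrakk> \<Longrightarrow>
      \<exists>w. integrable \<mu> w \<and> integral\<^sup>L \<mu> w \<le> 1 \<and> (\<forall>t. 0 \<le> w t) \<and>
        (AE t in \<mu>. norm (h t) powr p \<le> T + w t)"
    using Lr_ball_uniformly_integrable[OF assms(3,4) _ zero_less_one, of ?K \<mu>, where ?'x = 'x] by blast
  obtain w where w: "integrable \<mu> w" "\<And>t. 0 \<le> w t"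
    "AE t in \<mu>. norm (f t) powr p \<le> T + w t"
    using T(2)[OF assms(5) max.cobounded2] by blast
  have "integrable \<mu> (\<lambda>t. norm (f t) powr p)"
  proof (rule Bochner_Integration.integrable_bound)
    show "integrable \<mu> (\<lambda>t. T + w t)"
      using w by simp
    show "AE t in \<mu>. norm (norm (f t) powr p) \<le> norm (T + w t)"
      using w(3) by eventually_elim (use T(1) w(2) in auto)
  qed measurable
  then show ?thesis
    using bm by (simp add: bochner_Lq_def)
qed

lemma Lp_diff:
  fixes f g :: "'s \<Rightarrow> 'x::real_normed_vector"
  assumes "complete_measure \<mu>" "0 \<le> p" "f \<in> bochner_Lq \<mu> (ereal p)" "g \<in> bochner_Lq \<mu> (ereal p)"
  shows "(\<lambda>t. f t - g t) \<in> bochner_Lq \<mu> (ereal p)"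
proof -
  have bm: "bochner_measurable \<mu> (\<lambda>t. f t - g t)"
    using assms by (intro bochner_measurable_diff) (auto simp: bochner_Lq_def)
  note [measurable] = bochner_measurable_norm[OF assms(1) bm]
  have "integrable \<mu> (\<lambda>t. norm (f t - g t) powr p)"
  proof (rule Bochner_Integration.integrable_bound)
    show "integrable \<mu> (\<lambda>t. 2 powr p * (norm (f t) powr p + norm (g t) powr p))"
      using assms by (auto simp: bochner_Lq_def)
    have "norm (f t - g t) powr p \<le> 2 powr p * (norm (f t) powr p + norm (g t) powr p)" for t
    proof -
      have "norm (f t - g t) powr p \<le> (norm (f t) + norm (g t)) powr p"
        using assms by (intro powr_mono2 norm_triangle_ineq4) auto
      then show ?thesis
        using powr_add_le[OF assms(2), of "norm (f t)" "norm (g t)"] by simp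
    qed
    then show "AE t in \<mu>. norm (norm (f t - g t) powr p)
        \<le> norm (2 powr p * (norm (f t) powr p + norm (g t) powr p))"
      by (intro always_eventually allI) (simp add: abs_mult)
  qed measurable
  then show ?thesis
    using bm by (simp add: bochner_Lq_def)
qed

lemma Lq_norm_powr:
  assumes "0 < p"
  shows "Lq_norm \<mu> (ereal p) f powr p = (\<integral>t. norm (f t) powr p \<partial>\<mu>)"
  using assms by (simp add: Lq_norm_def powr_powr)

lemma Lq_norm_nonneg: "0 \<le> Lq_norm \<mu> q f"
  by (simp add: Lq_norm_def)

text \<open>
  Split \<open>\<epsilon> powr p \<le> \<integral>norm (f t) powr p\<close> into three parts: the values below \<open>\<delta>\<close> contribute at most
  \<open>\<epsilon> powr p / 4\<close> because the measure is finite, the part above the truncation height at most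
  \<open>\<epsilon> powr p / 4\<close> by uniform integrability, and the rest is at most a constant times the measure of the
  level set.
\<close>

lemma level_set_measure_ge:
  fixes \<mu> :: "'s measure" and p \<epsilon> K :: real and r :: ereal
  assumes "complete_measure \<mu>" "finite_measure \<mu>" "1 \<le> p" "ereal p < r" "0 < \<epsilon>" "0 < K"
  obtains \<delta> m where "0 < \<delta>" "0 < m"
    "\<And>f :: 's \<Rightarrow> 'x::real_normed_vector. \<lbrakk>f \<in> bochner_Lq \<mu> r; Lq_norm \<mu> r f \<le> K; \<epsilon> \<le> Lq_norm \<mu> (ereal p) f\<rbrakk>
      \<Longrightarrow> m \<le> measure \<mu> {t \<in> space \<mu>. \<delta> \<le> norm (f t)}"
proof -
  interpret finite_measure \<mu> by fact
  have \<theta>: "0 < \<epsilon> powr p / 4"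
    using assms by simp
  obtain T where T: "0 \<le> T"
    "\<And>f :: 's \<Rightarrow> 'x. \<lbrakk>f \<in> bochner_Lq \<mu> r; Lq_norm \<mu> r f \<le> K\<rbrakk> \<Longrightarrow>
      \<exists>w. integrable \<mu> w \<and> integral\<^sup>L \<mu> w \<le> \<epsilon> powr p / 4 \<and> (\<forall>t. 0 \<le> w t) \<and>
        (AE t in \<mu>. norm (f t) powr p \<le> T + w t)"
    using Lr_ball_uniformly_integrable[OF assms(3,4,6) \<theta>, where ?'x = 'x] by blast
  let ?S = "measure \<mu> (space \<mu>)"
  \<comment> \<open>The summand 1 avoids a division by zero when the measure space is null.\<close>
  define \<delta> where "\<delta> = (\<epsilon> powr p / (4 * (?S + 1))) powr (1 / p)"
  have pos_S: "0 < 4 * (?S + 1)"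
    by (simp add: add_nonneg_pos)
  have \<delta>: "0 < \<delta>" "\<delta> powr p = \<epsilon> powr p / (4 * (?S + 1))"
    using assms(3,5) pos_S by (simp_all add: \<delta>_def powr_powr)
  have "\<delta> powr p * ?S \<le> \<delta> powr p * (?S + 1)"
    by (intro mult_left_mono) auto
  also have "\<dots> = \<epsilon> powr p / 4"
    unfolding \<delta>(2) using pos_S by (simp add: field_simps)
  finally have \<delta>S: "\<delta> powr p * ?S \<le> \<epsilon> powr p / 4" .
  show thesis
  proof (rule that[of \<delta> "\<epsilon> powr p / (2 * (T + 1))"])
    show "0 < \<epsilon> powr p / (2 * (T + 1))"
      using T assms by simp
  next
    fix f :: "'s \<Rightarrow> 'x"
    assume f: "f \<in> bochner_Lq \<mu> r" "Lq_norm \<mu> r f \<le> K" "\<epsilon> \<le> Lq_norm \<mu> (ereal p) f"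
    obtain w where w: "integrable \<mu> w" "integral\<^sup>L \<mu> w \<le> \<epsilon> powr p / 4" "\<And>t. 0 \<le> w t"
      "AE t in \<mu>. norm (f t) powr p \<le> T + w t"
      using T(2)[OF f(1,2)] by blast
    have fp: "f \<in> bochner_Lq \<mu> (ereal p)"
      using assms f by (intro Lr_subset_Lp)
    note [measurable] = bochner_measurable_norm[OF assms(1), of f]
    let ?A = "{t \<in> space \<mu>. \<delta> \<le> norm (f t)}"
    have A[measurable]: "?A \<in> sets \<mu>"
      using fp by (auto simp: bochner_Lq_def)
    have intA: "integrable \<mu> (\<lambda>t. T * indicator ?A t)"
      by (intro integrable_mult_right integrable_real_indicator A) (auto simp: less_top[symmetric])
    have "\<epsilon> powr p \<le> Lq_norm \<mu> (ereal p) f powr p"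
      using assms f by (intro powr_mono2) auto
    also have "\<dots> = (\<integral>t. norm (f t) powr p \<partial>\<mu>)"
      using assms by (intro Lq_norm_powr) simp
    also have "\<dots> \<le> (\<integral>t. \<delta> powr p + T * indicator ?A t + w t \<partial>\<mu>)"
    proof (rule integral_mono_AE)
      show "integrable \<mu> (\<lambda>t. norm (f t) powr p)"
        using fp by (simp add: bochner_Lq_def)
      show "integrable \<mu> (\<lambda>t. \<delta> powr p + T * indicator ?A t + w t)"
        by (intro Bochner_Integration.integrable_add intA w integrable_const)
      show "AE t in \<mu>. norm (f t) powr p \<le> \<delta> powr p + T * indicator ?A t + w t"
        using w(4) AE_space
      proof eventually_elim
        case (elim t)
        show ?case
        proof (cases "t \<in> ?A")
          case True
          then show ?thesis
            using elim by (simp add: add.assoc add_increasing)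
        next
          case False
          then have "norm (f t) powr p \<le> \<delta> powr p"
            using assms elim by (intro powr_mono2) auto
          then show ?thesis
            using w(3)[of t] by (simp only: indicator_simps(2)[OF False])
        qed
      qed
    qed
    also have "\<dots> = \<delta> powr p * ?S + T * measure \<mu> ?A + integral\<^sup>L \<mu> w"
      using intA w(1) A by (simp add: Bochner_Integration.integral_add sets.Int_space_eq2 Int_absorb2)
    also have "\<dots> \<le> \<epsilon> powr p / 4 + T * measure \<mu> ?A + \<epsilon> powr p / 4"
      using \<delta>S w(2) by simp
    finally have "\<epsilon> powr p \<le> 2 * (T * measure \<mu> ?A)"
      by simp
    also have "\<dots> \<le> 2 * ((T + 1) * measure \<mu> ?A)"
      by (simp add: algebra_simps)
    finally show "\<epsilon> powr p / (2 * (T + 1)) \<le> measure \<mu> ?A"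
      using T(1) by (simp add: field_simps)
  qed (use \<delta> in simp)
qed

section \<open>Integrating the gap\<close>

text \<open>
  The functions \<open>W n\<close> to which Fatou's lemma is applied are nonnegative by \<open>powr_perturbation\<close>, and their
  lower limit is at least \<open>V\<close>: the nonnegative term \<open>e * a n t powr p\<close> is dropped there.
  In the integrals this term is at most \<open>e * B\<close>, and \<open>C * g t powr p\<close> occurs in both
  \<open>W n\<close> and \<open>V\<close> and cancels.
\<close>

lemma (in finite_measure) Fatou_powr_diff:
  fixes a b :: "nat \<Rightarrow> 'a \<Rightarrow> real" and g :: "'a \<Rightarrow> real" and p \<kappa> \<theta> B :: real
  assumes "1 \<le> p" "0 \<le> \<kappa>" "0 \<le> \<theta>" "0 \<le> B"
    and nonneg: "\<And>n t. 0 \<le> a n t" "\<And>n t. 0 \<le> b n t" "\<And>t. 0 \<le> g t"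
    and triangle: "\<And>n t. a n t - g t \<le> b n t"
    and a: "\<And>n. integrable M (\<lambda>t. a n t powr p)" and aB: "\<And>n. (\<integral>t. a n t powr p \<partial>M) \<le> B"
    and b: "\<And>n. integrable M (\<lambda>t. b n t powr p)"
    and g: "integrable M (\<lambda>t. g t powr p)"
    and A: "A \<in> sets M"
    and gap: "AE t in M. \<forall>c < \<kappa> * indicator A t. \<forall>\<^sub>F n in sequentially. c < b n t powr p - a n t powr p"
    and \<theta>: "\<theta> < \<kappa> * measure M A"
  shows "\<forall>\<^sub>F n in sequentially. \<theta> < (\<integral>t. b n t powr p \<partial>M) - (\<integral>t. a n t powr p \<partial>M)"
proof -
  \<comment> \<open>Chosen so that the error \<open>e * B\<close> stays below \<open>\<kappa> * measure M A - \<theta>\<close>.\<close>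
  define e where "e = (\<kappa> * measure M A - \<theta>) / (2 * (B + 1))"
  have e: "0 < e"
    using \<theta> assms(4) by (simp add: e_def)
  have "e * B \<le> e * (B + 1)"
    using e by (intro mult_left_mono) auto
  also have "\<dots> = (\<kappa> * measure M A - \<theta>) / 2"
    using assms(4) by (simp add: e_def field_simps)
  finally have eB: "e * B < \<kappa> * measure M A - \<theta>"
    using \<theta> by simp
  obtain C where C: "0 \<le> C"
    "\<And>a b g :: real. \<lbrakk>0 \<le> a; 0 \<le> b; 0 \<le> g; a - g \<le> b\<rbrakk> \<Longrightarrow> a powr p \<le> b powr p + e * a powr p + C * g powr p"
    using powr_perturbation[OF order_trans[OF zero_le_one assms(1)] e] by blast
  define W where "W n t = b n t powr p - a n t powr p + e * a n t powr p + C * g t powr p" for n t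
  define V where "V t = \<kappa> * indicator A t + C * g t powr p" for t
  let ?G = "\<integral>t. g t powr p \<partial>M"
  have G: "0 \<le> ?G"
    by (intro integral_nonneg_AE) simp
  have W0: "0 \<le> W n t" for n t
    using C(2)[OF nonneg(1)[of n t] nonneg(2)[of n t] nonneg(3)[of t] triangle[of n t]]
    by (simp add: W_def)
  have V0: "0 \<le> V t" for t
    using C(1) assms(2) by (simp add: V_def)
  have intA: "integrable M (\<lambda>t. \<kappa> * indicator A t)"
    by (intro integrable_mult_right integrable_real_indicator A) (auto simp: less_top[symmetric])
  have intW: "integrable M (W n)" for n
    unfolding W_def using a b g by simp
  have intV: "integrable M V"
    unfolding V_def using intA g by (intro Bochner_Integration.integrable_add) auto
  have IW: "integral\<^sup>L M (W n) = (\<integral>t. b n t powr p \<partial>M) - (\<integral>t. a n t powr p \<partial>M)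
      + e * (\<integral>t. a n t powr p \<partial>M) + C * ?G" for n
    unfolding W_def using a b g by simp
  have IV: "integral\<^sup>L M V = \<kappa> * measure M A + C * ?G"
    unfolding V_def using intA g A by (simp add: Bochner_Integration.integral_add sets.Int_space_eq2)
  have "AE t in M. ennreal (V t) \<le> liminf (\<lambda>n. ennreal (W n t))"
    using gap
  proof eventually_elim
    case (elim t)
    show ?case
      unfolding le_Liminf_iff
    proof (intro allI impI)
      fix y assume y: "y < ennreal (V t)"
      then obtain z where z: "y = ennreal z" "0 \<le> z"
        by (cases y) auto
      then have "z < V t"
        using y by (simp add: ennreal_less_iff)
      then have "z - C * g t powr p < \<kappa> * indicator A t"
        by (simp add: V_def)
      with elim have "\<forall>\<^sub>F n in sequentially. z - C * g t powr p < b n t powr p - a n t powr p"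
        by blast
      then show "\<forall>\<^sub>F n in sequentially. y < ennreal (W n t)"
      proof eventually_elim
        case (elim n)
        have "0 \<le> e * a n t powr p"
          using e by simp
        then have "z < W n t"
          using elim by (simp add: W_def)
        then show ?case
          using z by (simp add: ennreal_less_iff)
      qed
    qed
  qed
  then have "(\<integral>\<^sup>+t. ennreal (V t) \<partial>M) \<le> (\<integral>\<^sup>+t. liminf (\<lambda>n. ennreal (W n t)) \<partial>M)"
    by (rule nn_integral_mono_AE)
  also have "\<dots> \<le> liminf (\<lambda>n. \<integral>\<^sup>+t. ennreal (W n t) \<partial>M)"
    using intW by (intro nn_integral_liminf) (auto dest: borel_measurable_integrable)
  finally have "ennreal (integral\<^sup>L M V) \<le> liminf (\<lambda>n. ennreal (integral\<^sup>L M (W n)))"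
    using intW intV W0 V0 by (simp add: nn_integral_eq_integral)
  moreover
  let ?s = "\<theta> + e * B + C * ?G"
  have s: "0 \<le> ?s"
    using assms(3,4) e C(1) G by simp
  have "ennreal ?s < ennreal (integral\<^sup>L M V)"
    using eB s by (simp add: ennreal_less_iff IV)
  ultimately have "\<forall>\<^sub>F n in sequentially. ennreal ?s < ennreal (integral\<^sup>L M (W n))"
    unfolding le_Liminf_iff by blast
  then show ?thesis
  proof eventually_elim
    case (elim n)
    then have "?s < integral\<^sup>L M (W n)"
      using s by (simp add: ennreal_less_iff)
    moreover have "e * (\<integral>t. a n t powr p \<partial>M) \<le> e * B"
      using e aB by (intro mult_left_mono) auto
    ultimately show ?case
      by (simp add: IW)
  qed
qed

section \<open>The uniform Opial inequality in Lebesgue-Bochner spaces\<close>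

theorem theorem4p4:
  fixes \<mu> :: "'s measure" and p :: real and r :: ereal and \<epsilon> M R K :: real
  assumes "complete_measure \<mu>" and "finite_measure \<mu>"
    and "1 \<le> p"
    and "uniform_opial TYPE('x::banach)"
    and "ereal p < r"
    and "\<epsilon> > 0" and "M > 0" and "R > 0" and "K > 0"
  shows "\<exists>\<eta>::real. \<eta> > 0 \<and>
    (\<forall>(F :: nat \<Rightarrow> 's \<Rightarrow> 'x) (f :: 's \<Rightarrow> 'x).
      (\<forall>n. F n \<in> bochner_Lq \<mu> p \<and> Lq_norm \<mu> p (F n) \<le> R) \<longrightarrow>
      (AE t in \<mu>. weakly_converges (\<lambda>n. F n t) 0 \<and>
        (\<exists>l. (\<lambda>n. norm (F n t)) \<longlonglongrightarrow> l \<and> l \<le> M)) \<longrightarrow>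
      f \<in> bochner_Lq \<mu> r \<longrightarrow> Lq_norm \<mu> r f \<le> K \<longrightarrow> Lq_norm \<mu> p f \<ge> \<epsilon> \<longrightarrow>
      limsup (\<lambda>n. ereal (Lq_norm \<mu> p (F n))) + ereal \<eta>
        \<le> limsup (\<lambda>n. ereal (Lq_norm \<mu> p (\<lambda>t. F n t - f t))))"
proof -
  interpret finite_measure \<mu> by fact
  have p: "0 < p"
    using assms(3) by simp
  obtain \<delta> m where \<delta>: "0 < \<delta>" and m: "0 < m" and level:
    "\<And>f :: 's \<Rightarrow> 'x. \<lbrakk>f \<in> bochner_Lq \<mu> r; Lq_norm \<mu> r f \<le> K; \<epsilon> \<le> Lq_norm \<mu> (ereal p) f\<rbrakk>
      \<Longrightarrow> m \<le> measure \<mu> {t \<in> space \<mu>. \<delta> \<le> norm (f t)}"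
    using level_set_measure_ge[OF assms(1,2,3,5,6,9), where ?'x = 'x] by blast
  obtain \<eta>0 where \<eta>0: "0 < \<eta>0" and opial_gap:
    "\<And>(x::'x) xs l. \<lbrakk>\<delta> \<le> norm x; weakly_converges xs 0; (\<lambda>n. norm (xs n)) \<longlonglongrightarrow> l; l \<le> M\<rbrakk>
      \<Longrightarrow> ereal (l + \<eta>0) \<le> liminf (\<lambda>n. ereal (norm (xs n - x)))"
    using uniform_opial_gap[OF assms(4) \<delta> assms(7)] by blast
  \<comment> \<open>Half of the integrated gap: Fatou's lemma reaches only values strictly below it.\<close>
  define \<theta> where "\<theta> = \<eta>0 powr p * m / 2"
  have \<theta>: "0 < \<theta>" "\<theta> < \<eta>0 powr p * m"
    using \<eta>0 m by (auto simp: \<theta>_def)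
  obtain \<eta> where \<eta>: "0 < \<eta>" and root:
    "\<And>a b. \<lbrakk>0 \<le> a; a \<le> R; 0 \<le> b; a powr p + \<theta> \<le> b powr p\<rbrakk> \<Longrightarrow> a + \<eta> \<le> b"
    using powr_gap_root[OF p \<theta>(1)] by blast
  show ?thesis
  proof (intro exI[of _ \<eta>] conjI allI impI \<eta>)
    fix F :: "nat \<Rightarrow> 's \<Rightarrow> 'x" and f :: "'s \<Rightarrow> 'x"
    assume F: "\<forall>n. F n \<in> bochner_Lq \<mu> p \<and> Lq_norm \<mu> p (F n) \<le> R"
      and conv: "AE t in \<mu>. weakly_converges (\<lambda>n. F n t) 0 \<and>
        (\<exists>l. (\<lambda>n. norm (F n t)) \<longlonglongrightarrow> l \<and> l \<le> M)"
      and f: "f \<in> bochner_Lq \<mu> r" "Lq_norm \<mu> r f \<le> K" "Lq_norm \<mu> p f \<ge> \<epsilon>"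
    let ?A = "{t \<in> space \<mu>. \<delta> \<le> norm (f t)}"
    have fp: "f \<in> bochner_Lq \<mu> (ereal p)"
      using assms f by (intro Lr_subset_Lp)
    have diff: "(\<lambda>t. F n t - f t) \<in> bochner_Lq \<mu> (ereal p)" for n
      using assms F fp by (intro Lp_diff) auto
    have norm_f [measurable]: "(\<lambda>t. norm (f t)) \<in> borel_measurable \<mu>"
      using fp by (intro bochner_measurable_norm assms) (simp add: bochner_Lq_def)
    have "\<forall>\<^sub>F n in sequentially.
        \<theta> < (\<integral>t. norm (F n t - f t) powr p \<partial>\<mu>) - (\<integral>t. norm (F n t) powr p \<partial>\<mu>)"
    proof (rule Fatou_powr_diff)
      show "norm (F n t) - norm (f t) \<le> norm (F n t - f t)" for n t
        by (rule norm_triangle_ineq2)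
      show "integrable \<mu> (\<lambda>t. norm (F n t) powr p)" for n
        using F by (simp add: bochner_Lq_def)
      show "integrable \<mu> (\<lambda>t. norm (F n t - f t) powr p)" for n
        using diff by (simp add: bochner_Lq_def)
      show "integrable \<mu> (\<lambda>t. norm (f t) powr p)"
        using fp by (simp add: bochner_Lq_def)
      show "(\<integral>t. norm (F n t) powr p \<partial>\<mu>) \<le> R powr p" for n
      proof -
        have "Lq_norm \<mu> (ereal p) (F n) powr p \<le> R powr p"
          using p F by (intro powr_mono2 Lq_norm_nonneg) auto
        then show ?thesis
          using p by (simp add: Lq_norm_powr)
      qed
      show "?A \<in> sets \<mu>"
        by measurable
      show "\<theta> < \<eta>0 powr p * measure \<mu> ?A"
        using level[OF f] \<theta> \<eta>0
        by (meson less_le_trans mult_left_mono powr_ge_zero)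
      show "AE t in \<mu>. \<forall>c < \<eta>0 powr p * indicator ?A t. \<forall>\<^sub>F n in sequentially.
          c < norm (F n t - f t) powr p - norm (F n t) powr p"
        using conv
      proof eventually_elim
        case (elim t)
        then obtain l where w: "weakly_converges (\<lambda>n. F n t) 0"
          and l: "(\<lambda>n. norm (F n t)) \<longlonglongrightarrow> l" "l \<le> M"
          by blast
        show ?case
        proof (intro allI impI)
          fix c assume c: "c < \<eta>0 powr p * indicator ?A t"
          show "\<forall>\<^sub>F n in sequentially. c < norm (F n t - f t) powr p - norm (F n t) powr p"
          proof (cases "t \<in> ?A")
            case True
            then show ?thesis
              using c opial_gap[OF _ w l] assms(3) \<eta>0
              by (intro eventually_powr_diff_gt[where \<eta> = \<eta>0, OF _ _ _ _ l(1)]) auto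
          next
            case False
            then show ?thesis
              using c uniform_opial_liminf_ge[OF assms(4) w l(1), of "f t"] assms(3)
              by (intro eventually_powr_diff_gt[where \<eta> = 0, OF _ _ _ _ l(1)]) auto
          qed
        qed
      qed
    qed (use assms \<theta> in auto)
    then have "\<forall>\<^sub>F n in sequentially. ereal (Lq_norm \<mu> p (F n)) + ereal \<eta>
        \<le> ereal (Lq_norm \<mu> p (\<lambda>t. F n t - f t))"
    proof eventually_elim
      case (elim n)
      then have "Lq_norm \<mu> p (F n) powr p + \<theta> \<le> Lq_norm \<mu> p (\<lambda>t. F n t - f t) powr p"
        using p by (simp add: Lq_norm_powr)
      then have "Lq_norm \<mu> p (F n) + \<eta> \<le> Lq_norm \<mu> p (\<lambda>t. F n t - f t)"
        using F by (intro root Lq_norm_nonneg) auto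
      then show ?case
        by simp
    qed
    then have "limsup (\<lambda>n. ereal (Lq_norm \<mu> p (F n)) + ereal \<eta>)
        \<le> limsup (\<lambda>n. ereal (Lq_norm \<mu> p (\<lambda>t. F n t - f t)))"
      by (rule Limsup_mono)
    moreover have "limsup (\<lambda>n. ereal (Lq_norm \<mu> p (F n)) + ereal \<eta>)
        = limsup (\<lambda>n. ereal (Lq_norm \<mu> p (F n))) + ereal \<eta>"
      by (rule Limsup_add_ereal_right) auto
    ultimately show "limsup (\<lambda>n. ereal (Lq_norm \<mu> p (F n))) + ereal \<eta>
        \<le> limsup (\<lambda>n. ereal (Lq_norm \<mu> p (\<lambda>t. F n t - f t)))"
      by simp
  qed
qed

end
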